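(* Let $A$ be a zero annihilator evolution algebra over a field $K$. Then there is a direct sum decomposition $A=\bigoplus_{\alpha\in\Gamma}A_\alpha$, where each $A_\alpha$ is a nonzero ideal of $A$ that is indecomposable as an algebra on its own, and $\mathcal C(A_\alpha)\cong K$. Moreover, $\mathcal C(A)\cong K^{\mathfrak C}$, where $\mathfrak C$ is the set of connected components of any graph associated to $A$ (relative to any natural basis). Also, $|\Gamma|=|\mathfrak C|$.
   Context: Algebras are not assumed associative. An evolution algebra over $K$ is a $K$-algebra $A$ having a basis $B=\{e_i\}_{i\in\Lambda}$ (a natural basis) with $e_ie_j=0$ for all $i\ne j$. Write $e_i^2=\sum_{j\in\Lambda}\omega_{ji}e_j$. The directed graph associated to $A$ relative to $B$ has vertex set $\{e_i\}_{i\in\Lambda}$ and exactly one edge from $e_i$ to $e_j$ if $\omega_{ji}\neq 0$, and none otherwise. Connected components of the graph are the classes of vertices for the equivalence relation generated by the existence of an edge (in either direction) between two vertices. $A$ is a zero annihilator algebra if $\{x\in A: xA=Ax=0\}=0$. An algebra is decomposable if it is a direct sum $I\oplus J$ of two nonzero ideals, and indecomposable otherwise. The centroid $\mathcal C(A)$ of a $K$-algebra $A$ is the set of all $K$-linear maps $T:A\to A$ with $T(xy)=xT(y)=T(x)y$ for all $x,y\in A$; it is a $K$-algebra under addition and composition. $K^{\mathfrak C}$ is the $K$-algebra of all maps $\mathfrak C\to K$ with pointwise operations. The isomorphisms $\cong$ are of $K$-algebras. *)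

theory Defs
  imports Complex_Main "HOL-Library.FuncSet" "HOL-Library.Equipollence" "HOL-Algebra.Module" "HOL-Algebra.QuotRing"
begin

text \<open>
  A \<open>K\<close>-algebra \<open>A\<close> is given by a type \<open>'a\<close> of vectors over a field type \<open>'k\<close>, with scalar
  multiplication \<open>s\<close> and bilinear product \<open>m\<close>.  Neither associativity nor a unit is assumed,
  and the dimension is arbitrary.
\<close>

locale nonassoc_algebra = vector_space s
  for s :: "'k::field \<Rightarrow> 'a::ab_group_add \<Rightarrow> 'a" +
  fixes m :: "'a \<Rightarrow> 'a \<Rightarrow> 'a"
  assumes linear_left: "Vector_Spaces.linear s s (\<lambda>x. m x y)"
    and linear_right: "Vector_Spaces.linear s s (\<lambda>y. m x y)"

definition natural_basis ::
  "('k::field \<Rightarrow> 'a::ab_group_add \<Rightarrow> 'a) \<Rightarrow> ('a \<Rightarrow> 'a \<Rightarrow> 'a) \<Rightarrow> 'a set \<Rightarrow> bool" where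
  "natural_basis s m B \<longleftrightarrow>
     \<not> module.dependent s B \<and> module.span s B = UNIV \<and>
     (\<forall>e\<in>B. \<forall>f\<in>B. e \<noteq> f \<longrightarrow> m e f = 0)"

locale evolution_algebra = nonassoc_algebra s m
  for s :: "'k::field \<Rightarrow> 'a::ab_group_add \<Rightarrow> 'a" and m :: "'a \<Rightarrow> 'a \<Rightarrow> 'a" +
  assumes ex_natural_basis: "\<exists>B. natural_basis s m B"

definition annihilator :: "('a::ab_group_add \<Rightarrow> 'a \<Rightarrow> 'a) \<Rightarrow> 'a set" where
  "annihilator m = {x. \<forall>y. m x y = 0 \<and> m y x = 0}"

text \<open>
  The coefficient of \<open>f\<close> in \<open>e\<^sup>2\<close> (the structure constant \<open>\<omega>\<^sub>f\<^sub>e\<close>) is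
  \<open>module.representation s B (m e e) f\<close>.
\<close>

definition evolution_edges ::
  "('k::field \<Rightarrow> 'a::ab_group_add \<Rightarrow> 'a) \<Rightarrow> ('a \<Rightarrow> 'a \<Rightarrow> 'a) \<Rightarrow> 'a set \<Rightarrow> ('a \<times> 'a) set" where
  "evolution_edges s m B =
     {(e, f). e \<in> B \<and> f \<in> B \<and> module.representation s B (m e e) f \<noteq> 0}"

definition graph_components ::
  "('k::field \<Rightarrow> 'a::ab_group_add \<Rightarrow> 'a) \<Rightarrow> ('a \<Rightarrow> 'a \<Rightarrow> 'a) \<Rightarrow> 'a set \<Rightarrow> 'a set set" where
  "graph_components s m B =
     B // (evolution_edges s m B \<union> (evolution_edges s m B)\<inverse>)\<^sup>*"

text \<open>
  In the following definitions \<open>S\<close> is a subspace of \<open>A\<close> closed under \<open>m\<close>, regarded as an algebra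
  on its own; \<open>A\<close> itself is the case \<open>S = UNIV\<close>.
\<close>

definition alg_ideal ::
  "('k::field \<Rightarrow> 'a::ab_group_add \<Rightarrow> 'a) \<Rightarrow> ('a \<Rightarrow> 'a \<Rightarrow> 'a) \<Rightarrow> 'a set \<Rightarrow> 'a set \<Rightarrow> bool" where
  "alg_ideal s m S I \<longleftrightarrow>
     I \<subseteq> S \<and> module.subspace s I \<and> (\<forall>x\<in>I. \<forall>y\<in>S. m x y \<in> I \<and> m y x \<in> I)"

definition decomposable ::
  "('k::field \<Rightarrow> 'a::ab_group_add \<Rightarrow> 'a) \<Rightarrow> ('a \<Rightarrow> 'a \<Rightarrow> 'a) \<Rightarrow> 'a set \<Rightarrow> bool" where
  "decomposable s m S \<longleftrightarrow>
     (\<exists>I J. alg_ideal s m S I \<and> alg_ideal s m S J \<and> I \<noteq> {0} \<and> J \<noteq> {0} \<and>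
            I \<inter> J = {0} \<and> S = {x + y |x y. x \<in> I \<and> y \<in> J})"

text \<open>The sum of a family of subspaces is the span of its union.\<close>

definition direct_sum_family ::
  "('k::field \<Rightarrow> 'a::ab_group_add \<Rightarrow> 'a) \<Rightarrow> 'i set \<Rightarrow> ('i \<Rightarrow> 'a set) \<Rightarrow> bool" where
  "direct_sum_family s \<Gamma> F \<longleftrightarrow>
     (\<forall>\<alpha>\<in>\<Gamma>. module.subspace s (F \<alpha>)) \<and>
     module.span s (\<Union>\<alpha>\<in>\<Gamma>. F \<alpha>) = UNIV \<and>
     (\<forall>\<alpha>\<in>\<Gamma>. F \<alpha> \<inter> module.span s (\<Union>\<beta>\<in>\<Gamma> - {\<alpha>}. F \<beta>) = {0})"

text \<open>
  Associative unital \<open>K\<close>-algebras are represented by the \<open>HOL-Algebra\<close> record type \<open>module\<close>,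
  which has ring operations and scalar multiplication; the scalars are the whole type \<open>'k\<close>.
  Maps with domain \<open>S\<close> are represented extensionally, i.e. they are \<open>undefined\<close> outside \<open>S\<close>.
\<close>

definition centroid ::
  "('k::field \<Rightarrow> 'a::ab_group_add \<Rightarrow> 'a) \<Rightarrow> ('a \<Rightarrow> 'a \<Rightarrow> 'a) \<Rightarrow> 'a set \<Rightarrow> ('k, 'a \<Rightarrow> 'a) module" where
  "centroid s m S =
     \<lparr>carrier = {T \<in> S \<rightarrow>\<^sub>E S.
        (\<forall>x\<in>S. \<forall>y\<in>S. T (x + y) = T x + T y) \<and>
        (\<forall>c. \<forall>x\<in>S. T (s c x) = s c (T x)) \<and>
        (\<forall>x\<in>S. \<forall>y\<in>S. T (m x y) = m x (T y) \<and> T (m x y) = m (T x) y)},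
      mult = compose S,
      one = (\<lambda>x\<in>S. x),
      zero = (\<lambda>x\<in>S. 0),
      add = (\<lambda>T U. \<lambda>x\<in>S. T x + U x),
      smult = (\<lambda>c T. \<lambda>x\<in>S. s c (T x))\<rparr>"

definition base_algebra :: "('k::field, 'k) module" where
  "base_algebra =
     \<lparr>carrier = UNIV, mult = (*), one = 1, zero = 0, add = (+), smult = (*)\<rparr>"

definition function_algebra :: "'c set \<Rightarrow> ('k::field, 'c \<Rightarrow> 'k) module" where
  "function_algebra C =
     \<lparr>carrier = C \<rightarrow>\<^sub>E UNIV,
      mult = (\<lambda>f g. \<lambda>c\<in>C. f c * g c),
      one = (\<lambda>c\<in>C. 1),
      zero = (\<lambda>c\<in>C. 0),
      add = (\<lambda>f g. \<lambda>c\<in>C. f c + g c),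
      smult = (\<lambda>a f. \<lambda>c\<in>C. a * f c)\<rparr>"

definition algebra_isomorphic ::
  "('k::field, 'b) module \<Rightarrow> ('k, 'c) module \<Rightarrow> bool" where
  "algebra_isomorphic R R' \<longleftrightarrow>
     (\<exists>h \<in> ring_iso R R'. \<forall>c. \<forall>x\<in>carrier R. h (c \<odot>\<^bsub>R\<^esub> x) = c \<odot>\<^bsub>R'\<^esub> h x)"

end

theory Submission
  imports Defs
begin

text \<open>
  Fix a natural basis \<open>B\<close>. Since the annihilator is zero, every \<open>e \<in> B\<close> has a nonzero square, and
  right multiplication by \<open>e\<close> sends \<open>x\<close> to its coordinate at \<open>e\<close> times this square. Hence products
  with basis vectors read off coordinates. For \<open>T\<close> in the centroid and \<open>f \<noteq> e\<close> in \<open>B\<close>, the product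
  of \<open>T e\<close> and \<open>f\<close> is \<open>T\<close> of the product of \<open>e\<close> and \<open>f\<close>, which is zero; so \<open>T\<close> is diagonal in
  the basis \<open>B\<close> (\<open>centroidal_basis\<close>). Applying \<open>T\<close> to the square of \<open>e\<close> shows that two basis
  vectors joined by an edge have the same eigenvalue (\<open>eigenvalue_edge\<close>). So \<open>T\<close> is a homothety on
  the span of every component, and conversely any choice of one scalar for each component gives
  an element of the centroid (\<open>ex_centroidal\<close>). This is the isomorphism of the centroid with the
  algebra of functions on the components.

  The choice \<open>1\<close> on one component and \<open>0\<close> on the others gives a projection in the centroid, whose
  range, the span of that component, is therefore an ideal. An element of the centroid of this
  ideal extends by zero to the whole algebra, so it is a homothety: the centroid of the ideal is
  the base field. The projections attached to a decomposition of an algebra into two ideals always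
  lie in its centroid, and they are not homotheties if both ideals are nonzero, so each of these
  ideals is indecomposable.

  It remains to see that another natural basis has as many components. In fact the family of
  ideals itself does not depend on the basis: they are the minimal nonzero ranges of idempotents of
  the centroid. Concretely, each range of a nonzero idempotent contains the span of some component
  of any natural basis (\<open>idempotent_range_contains_component\<close>), and two natural bases can be played
  against each other (\<open>component_spans_subset\<close>).
\<close>

section \<open>Nonassociative algebras and their centroids\<close>

context nonassoc_algebra
begin

sublocale endo: vector_space_pair s s
  by unfold_locales

lemma linear_endoI:
  assumes "\<And>x y. T (x + y) = T x + T y" and "\<And>c x. T (s c x) = s c (T x)"
  shows "Vector_Spaces.linear s s T"
  using assms by (simp add: Vector_Spaces.linear_iff vector_space_axioms)

lemma linear_endoD:
  assumes "Vector_Spaces.linear s s T"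
  shows "T (x + y) = T x + T y" and "T (s c x) = s c (T x)"
  using assms by (simp_all add: Vector_Spaces.linear_iff)

lemmas mult_add_left = linear_endoD(1)[OF linear_left]
  and mult_add_right = linear_endoD(1)[OF linear_right]
  and mult_scale_left = linear_endoD(2)[OF linear_left]
  and mult_scale_right = linear_endoD(2)[OF linear_right]

definition centroidal :: "('a \<Rightarrow> 'a) \<Rightarrow> bool" where
  "centroidal T \<longleftrightarrow> Vector_Spaces.linear s s T \<and>
     (\<forall>x y. T (m x y) = m x (T y) \<and> T (m x y) = m (T x) y)"

lemma centroid_carrier_iff:
  "T \<in> carrier (centroid s m S) \<longleftrightarrow> T \<in> S \<rightarrow>\<^sub>E S \<and>
     (\<forall>x\<in>S. \<forall>y\<in>S. T (x + y) = T x + T y) \<and> (\<forall>c. \<forall>x\<in>S. T (s c x) = s c (T x)) \<and>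
     (\<forall>x\<in>S. \<forall>y\<in>S. T (m x y) = m x (T y) \<and> T (m x y) = m (T x) y)"
  by (simp only: centroid_def partial_object.select_convs mem_Collect_eq)

lemma centroid_UNIV_iff: "T \<in> carrier (centroid s m UNIV) \<longleftrightarrow> centroidal T"
  by (auto simp: centroid_def centroidal_def Vector_Spaces.linear_iff vector_space_axioms)

lemma centroidal_linear: "centroidal T \<Longrightarrow> Vector_Spaces.linear s s T"
  and centroidal_mult_right: "centroidal T \<Longrightarrow> T (m x y) = m x (T y)"
  and centroidal_mult_left: "centroidal T \<Longrightarrow> T (m x y) = m (T x) y"
  unfolding centroidal_def by blast+

text \<open>This is meaningful only if \<open>S\<close> has a nonzero element and \<open>T\<close> is a homothety on \<open>S\<close>.\<close>

definition scalar_on :: "'a set \<Rightarrow> ('a \<Rightarrow> 'a) \<Rightarrow> 'k" where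
  "scalar_on S T = (THE c. \<forall>x\<in>S. T x = s c x)"

lemma scalar_on_eqI:
  assumes "x \<in> S" and "x \<noteq> 0" and "\<And>x. x \<in> S \<Longrightarrow> T x = s c x"
  shows "scalar_on S T = c"
  unfolding scalar_on_def
proof (rule the_equality)
  show "\<forall>x\<in>S. T x = s c x" using assms by blast
  fix d assume "\<forall>x\<in>S. T x = s d x"
  then have "s d x = s c x" using assms by metis
  then show "d = c" using assms(2) by simp
qed

text \<open>If every element of the centroid is a homothety, the coefficient of the homothety is the
  isomorphism; a nonzero vector makes this coefficient unique.\<close>

lemma centroid_iso_base_algebra:
  assumes sub: "subspace S" and closed: "\<And>x y. x \<in> S \<Longrightarrow> y \<in> S \<Longrightarrow> m x y \<in> S"
    and ne: "S \<noteq> {0}"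
    and scalar: "\<And>T. T \<in> carrier (centroid s m S) \<Longrightarrow> \<exists>c. \<forall>x\<in>S. T x = s c x"
  shows "algebra_isomorphic (centroid s m S) (base_algebra :: ('k, 'k) module)"
proof -
  let ?R = "centroid s m S"
  obtain z where z: "z \<in> S" "z \<noteq> 0" using ne subspace_0[OF sub] by blast
  note eqI = scalar_on_eqI[OF z]
  have act: "T x = s (scalar_on S T) x" if "T \<in> carrier ?R" "x \<in> S" for T x
    using scalar[OF that(1)] eqI that(2) by metis
  have maps: "T x \<in> S" if "T \<in> carrier ?R" "x \<in> S" for T x
    using that by (auto simp: centroid_def)
  have mult: "scalar_on S (mult ?R T U) = scalar_on S T * scalar_on S U"
    if "T \<in> carrier ?R" "U \<in> carrier ?R" for T U
  proof (rule eqI)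
    fix x assume x: "x \<in> S"
    have "T (U x) = s (scalar_on S T) (U x)" by (rule act[OF that(1) maps[OF that(2) x]])
    then show "mult ?R T U x = s (scalar_on S T * scalar_on S U) x"
      using x act[OF that(2) x] by (simp add: centroid_def compose_def)
  qed
  have add: "scalar_on S (add ?R T U) = scalar_on S T + scalar_on S U"
    if "T \<in> carrier ?R" "U \<in> carrier ?R" for T U
    by (rule eqI) (simp add: centroid_def act[OF that(1), symmetric] act[OF that(2), symmetric]
        scale_left_distrib)
  have one: "scalar_on S (one ?R) = 1"
    by (rule eqI) (simp add: centroid_def)
  have smult: "scalar_on S (smult ?R c T) = c * scalar_on S T" if "T \<in> carrier ?R" for c T
    by (rule eqI) (simp add: centroid_def act[OF that, symmetric] del: scale_scale add: scale_scale[symmetric])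
  have bij: "bij_betw (scalar_on S) (carrier ?R) UNIV"
  proof (rule bij_betw_imageI)
    show "inj_on (scalar_on S) (carrier ?R)"
    proof (rule inj_onI)
      fix T U assume T: "T \<in> carrier ?R" and U: "U \<in> carrier ?R"
        and eq: "scalar_on S T = scalar_on S U"
      show "T = U"
      proof (rule extensionalityI)
        show "T \<in> extensional S" "U \<in> extensional S"
          using T U by (auto simp: centroid_def PiE_def)
        show "T x = U x" if "x \<in> S" for x using act[OF T that] act[OF U that] eq by simp
      qed
    qed
    show "scalar_on S ` carrier ?R = UNIV"
    proof (intro equalityI subset_UNIV subsetI)
      fix c :: 'k
      have "(\<lambda>x\<in>S. s c x) \<in> carrier ?R"
        using subspace_add[OF sub] subspace_scale[OF sub] closed
        by (auto simp: centroid_def scale_right_distrib mult.commute mult_scale_left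
            mult_scale_right)
      moreover have "scalar_on S (\<lambda>x\<in>S. s c x) = c" by (rule eqI) simp
      ultimately show "c \<in> scalar_on S ` carrier ?R" by (metis imageI)
    qed
  qed
  have "scalar_on S \<in> ring_iso ?R base_algebra"
    by (rule ring_iso_memI) (use mult add one bij in \<open>simp_all add: base_algebra_def\<close>)
  then show ?thesis
    unfolding algebra_isomorphic_def using smult by (auto simp: base_algebra_def)
qed

text \<open>For \<open>S = I \<oplus> J\<close> the products between \<open>I\<close> and \<open>J\<close> lie in \<open>I \<inter> J = 0\<close>, so the projection
  onto \<open>I\<close> belongs to the centroid. It is not a homothety when both summands are nonzero.\<close>

lemma scalar_centroid_imp_indecomposable:
  assumes scalar: "\<And>T. T \<in> carrier (centroid s m S) \<Longrightarrow> \<exists>c. \<forall>x\<in>S. T x = s c x"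
  shows "\<not> decomposable s m S"
proof
  assume "decomposable s m S"
  then obtain I J where I: "alg_ideal s m S I" and J: "alg_ideal s m S J"
    and ne: "I \<noteq> {0}" "J \<noteq> {0}" and int: "I \<inter> J = {0}"
    and S: "S = {x + y |x y. x \<in> I \<and> y \<in> J}"
    unfolding decomposable_def by blast
  have subI: "subspace I" and subJ: "subspace J" and IS: "I \<subseteq> S" and JS: "J \<subseteq> S"
    using I J by (simp_all add: alg_ideal_def)
  have cross: "m i j = 0" "m j i = 0" if "i \<in> I" "j \<in> J" for i j
    using I J int IS JS that unfolding alg_ideal_def by blast+
  define T where "T = (\<lambda>x\<in>S. THE i. i \<in> I \<and> (\<exists>j\<in>J. x = i + j))"
  have T: "T (i + j) = i" if "i \<in> I" "j \<in> J" for i j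
  proof -
    have "(THE i'. i' \<in> I \<and> (\<exists>j'\<in>J. i + j = i' + j')) = i"
    proof (rule the_equality)
      show "i \<in> I \<and> (\<exists>j'\<in>J. i + j = i + j')" using that by blast
      fix i' assume "i' \<in> I \<and> (\<exists>j'\<in>J. i + j = i' + j')"
      then obtain j' where i': "i' \<in> I" and j': "j' \<in> J" and eq: "i + j = i' + j'" by blast
      have "i' - i = j - j'" using eq by (simp add: algebra_simps)
      moreover have "i' - i \<in> I" "j - j' \<in> J"
        using subspace_diff subI subJ that i' j' by blast+
      ultimately have "i' - i \<in> I \<inter> J" by simp
      then show "i' = i" using int by simp
    qed
    moreover have "i + j \<in> S" using that S by blast
    ultimately show ?thesis by (simp add: T_def)
  qed
  have "T \<in> carrier (centroid s m S)"
  proof -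
    have ext: "T \<in> S \<rightarrow>\<^sub>E S"
    proof (rule PiE_I)
      show "T x \<in> S" if "x \<in> S" for x using that T S IS by auto
    qed (simp add: T_def)
    have add: "T (x + y) = T x + T y" if xy: "x \<in> S" "y \<in> S" for x y
    proof -
      obtain i j i' j' where ij: "x = i + j" "y = i' + j'" "i \<in> I" "j \<in> J" "i' \<in> I" "j' \<in> J"
        using xy S by blast
      have "x + y = (i + i') + (j + j')" using ij by (simp add: algebra_simps)
      then have "T (x + y) = i + i'"
        using T subspace_add[OF subI ij(3,5)] subspace_add[OF subJ ij(4,6)] by simp
      then show ?thesis using ij T by simp
    qed
    have scale: "T (s c x) = s c (T x)" if x: "x \<in> S" for c x
    proof -
      obtain i j where ij: "x = i + j" "i \<in> I" "j \<in> J" using x S by blast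
      then show ?thesis using T subspace_scale[OF subI] subspace_scale[OF subJ]
        by (simp add: scale_right_distrib)
    qed
    have mult: "T (m x y) = m x (T y) \<and> T (m x y) = m (T x) y" if xy: "x \<in> S" "y \<in> S" for x y
    proof -
      obtain i j i' j' where ij: "x = i + j" "y = i' + j'" "i \<in> I" "j \<in> J" "i' \<in> I" "j' \<in> J"
        using xy S by blast
      have "m x y = m i i' + m j j'" "m x i' = m i i'" "m i y = m i i'"
        using ij cross by (simp_all add: mult_add_left mult_add_right)
      moreover have "m i i' \<in> I" "m j j' \<in> J"
        using I J IS JS ij unfolding alg_ideal_def by blast+
      ultimately show ?thesis using T ij by simp
    qed
    show ?thesis unfolding centroid_carrier_iff using ext add scale mult by blast
  qed
  then obtain c where c: "T x = s c x" if "x \<in> S" for x using scalar by blast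
  obtain i j where i: "i \<in> I" "i \<noteq> 0" and j: "j \<in> J" "j \<noteq> 0"
    using ne subspace_0[OF subI] subspace_0[OF subJ] by blast
  have "s c i = i" using T[OF i(1) subspace_0[OF subJ]] c[of i] i IS by auto
  moreover have "s c j = 0" using T[OF subspace_0[OF subI] j(1)] c[of j] j JS by auto
  ultimately show False using i(2) j(2) by auto
qed

end

section \<open>The centroid in terms of a natural basis\<close>

locale zero_annihilator_evolution_algebra = nonassoc_algebra s m
  for s :: "'k::field \<Rightarrow> 'a::ab_group_add \<Rightarrow> 'a" and m :: "'a \<Rightarrow> 'a \<Rightarrow> 'a" +
  fixes B :: "'a set"
  assumes basis: "natural_basis s m B" and zero_annihilator: "annihilator m = {0}"
begin

abbreviation "coord \<equiv> representation B"
abbreviation "edges \<equiv> evolution_edges s m B"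
abbreviation "linked \<equiv> (edges \<union> edges\<inverse>)\<^sup>*"
abbreviation "components \<equiv> graph_components s m B"

lemma independent_B: "independent B"
  and span_B: "span B = UNIV"
  and orthogonal: "e \<in> B \<Longrightarrow> f \<in> B \<Longrightarrow> e \<noteq> f \<Longrightarrow> m e f = 0"
  using basis by (auto simp: natural_basis_def)

lemma linear_eq_on_basis:
  assumes "Vector_Spaces.linear s s T" and "Vector_Spaces.linear s s U"
    and "\<And>e. e \<in> B \<Longrightarrow> T e = U e"
  shows "T x = U x"
  using endo.linear_eq_on[OF assms(1,2), of x B] assms(3) span_B by simp

lemma coord_basis: "e \<in> B \<Longrightarrow> coord e f = (if f = e then 1 else 0)"
  using representation_basis[OF independent_B] by simp

lemma linear_coord_scale: "Vector_Spaces.linear s s (\<lambda>x. s (coord x e) v)"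
  by (rule linear_endoI)
    (simp_all add: representation_add[OF independent_B] representation_scale[OF independent_B]
      span_B scale_left_distrib)

lemma mult_basis_right: "e \<in> B \<Longrightarrow> m x e = s (coord x e) (m e e)"
  by (rule linear_eq_on_basis[of "\<lambda>x. m x e", OF linear_left linear_coord_scale])
    (auto simp: coord_basis orthogonal)

lemma mult_basis_left: "e \<in> B \<Longrightarrow> m e x = s (coord x e) (m e e)"
  by (rule linear_eq_on_basis[of "\<lambda>x. m e x", OF linear_right linear_coord_scale])
    (auto simp: coord_basis orthogonal)

lemma basis_nonzero: "e \<in> B \<Longrightarrow> e \<noteq> 0"
  using dependent_zero independent_B by blast

text \<open>A basis vector with zero square would annihilate the whole algebra.\<close>

lemma square_nonzero:
  assumes "e \<in> B" shows "m e e \<noteq> 0"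
proof
  assume "m e e = 0"
  then have "m e x = 0" "m x e = 0" for x
    unfolding mult_basis_left[OF assms, of x] mult_basis_right[OF assms, of x] by simp_all
  then have "e \<in> annihilator m" by (simp add: annihilator_def)
  then show False using zero_annihilator basis_nonzero[OF assms] by simp
qed

lemma eq_scaled_basisI:
  assumes "e \<in> B" and "\<And>f. f \<in> B \<Longrightarrow> f \<noteq> e \<Longrightarrow> coord x f = 0"
  shows "x = s (coord x e) e"
proof -
  have sub: "{f. coord x f \<noteq> 0} \<subseteq> {e}"
    using assms(2) representation_ne_zero[of B x] by blast
  have "x = (\<Sum>f | coord x f \<noteq> 0. s (coord x f) f)"
    using sum_nonzero_representation_eq[OF independent_B] span_B by simp
  also have "\<dots> = (\<Sum>f\<in>{e}. s (coord x f) f)"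
    using sub by (intro sum.mono_neutral_left) auto
  finally show ?thesis by simp
qed

text \<open>Multiplying by another basis vector \<open>f\<close> detects the coordinate at \<open>f\<close> because \<open>f\<close> has nonzero
  square, and \<open>m (T e) f = T (m e f) = 0\<close>. So the natural basis diagonalises the centroid.\<close>

lemma centroidal_basis:
  assumes T: "centroidal T" and e: "e \<in> B"
  shows "T e = s (coord (T e) e) e"
proof (rule eq_scaled_basisI[OF e])
  fix f assume f: "f \<in> B" "f \<noteq> e"
  have "s (coord (T e) f) (m f f) = m (T e) f" by (rule mult_basis_right[OF f(1), symmetric])
  also have "\<dots> = T (m e f)" using centroidal_mult_left[OF T] by simp
  also have "\<dots> = 0"
    using orthogonal[OF e f(1)] f(2) endo.linear_0[OF centroidal_linear[OF T]] by simp
  finally show "coord (T e) f = 0" using square_nonzero[OF f(1)] by simp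
qed

text \<open>Shifting \<open>T\<close> between the factors of \<open>m x f\<close> compares the coordinate of \<open>T x\<close> at \<open>f\<close> with that
  of \<open>x\<close>; this avoids expanding \<open>x\<close> as a finite sum.\<close>

lemma coord_centroidal:
  assumes T: "centroidal T" and f: "f \<in> B"
  shows "coord (T x) f = coord (T f) f * coord x f"
proof -
  have "s (coord (T x) f) (m f f) = m (T x) f" by (rule mult_basis_right[OF f, symmetric])
  also have "\<dots> = m x (T f)"
    using centroidal_mult_left[OF T] centroidal_mult_right[OF T] by metis
  also have "\<dots> = s (coord (T f) f) (m x f)"
    using centroidal_basis[OF T f] mult_scale_right by metis
  also have "\<dots> = s (coord (T f) f * coord x f) (m f f)"
    by (metis mult_basis_right[OF f] scale_scale)
  finally show ?thesis using square_nonzero[OF f] by simp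
qed

text \<open>Comparing the coordinates at \<open>f\<close> of \<open>T (m e e) = m (T e) e\<close> shows that the eigenvalues at \<open>e\<close>
  and \<open>f\<close> agree as soon as \<open>f\<close> occurs in \<open>m e e\<close>.\<close>

lemma eigenvalue_edge:
  assumes T: "centroidal T" and "(e, f) \<in> edges"
  shows "coord (T e) e = coord (T f) f"
proof -
  have e: "e \<in> B" and f: "f \<in> B" and nz: "coord (m e e) f \<noteq> 0"
    using assms(2) by (auto simp: evolution_edges_def)
  have "T (m e e) = m (T e) e" by (rule centroidal_mult_left[OF T])
  also have "\<dots> = s (coord (T e) e) (m e e)" by (rule mult_basis_right[OF e])
  finally have "coord (T (m e e)) f = coord (T e) e * coord (m e e) f"
    using representation_scale[OF independent_B] span_B by simp
  moreover have "coord (T (m e e)) f = coord (T f) f * coord (m e e) f"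
    by (rule coord_centroidal[OF T f])
  ultimately show ?thesis using nz by (metis mult_right_cancel)
qed

lemma eigenvalue_linked:
  assumes "centroidal T" and "(e, f) \<in> linked"
  shows "coord (T e) e = coord (T f) f"
  using assms(2) by (induction) (use eigenvalue_edge[OF assms(1)] in auto)

lemma equiv_linked: "equiv UNIV linked"
proof (rule equivI)
  have "sym (edges \<union> edges\<inverse>)" by (auto simp: sym_def)
  then show "sym linked" by (rule sym_rtrancl)
qed (auto simp: refl_rtrancl trans_rtrancl)

lemma linked_in_B: "(e, f) \<in> linked \<Longrightarrow> e \<in> B \<Longrightarrow> f \<in> B"
  by (induction rule: rtrancl_induct) (auto simp: evolution_edges_def)

lemma component_of: "e \<in> B \<Longrightarrow> linked `` {e} \<in> components"
  by (auto simp: graph_components_def quotient_def)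

lemma component_eq:
  assumes "C \<in> components" and "e \<in> C" shows "C = linked `` {e}"
proof -
  obtain f where f: "C = linked `` {f}" using assms by (auto simp: graph_components_def quotient_def)
  then have "(f, e) \<in> linked" using assms by blast
  then show ?thesis using equiv_class_eq[OF equiv_linked] f by blast
qed

lemma component_subset: "C \<in> components \<Longrightarrow> C \<subseteq> B"
  by (auto simp: graph_components_def quotient_def dest: linked_in_B)

lemma component_nonempty:
  assumes "C \<in> components" obtains e where "e \<in> C" and "e \<in> B" and "e \<noteq> 0" and "e \<in> span C"
proof -
  obtain e where e: "e \<in> B" "C = linked `` {e}"
    using assms by (auto simp: graph_components_def quotient_def)
  then have "e \<in> C" by blast
  then show ?thesis using that e basis_nonzero span_base by blast
qed

lemma square_in_component_span:
  assumes "C \<in> components" and "e \<in> C" shows "m e e \<in> span C"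
proof -
  have e: "e \<in> B" using assms component_subset by blast
  have sup: "f \<in> C" if "coord (m e e) f \<noteq> 0" for f
  proof -
    have "(e, f) \<in> edges"
      using that e representation_ne_zero[of B] by (auto simp: evolution_edges_def)
    then show ?thesis using component_eq[OF assms] by blast
  qed
  have "m e e = (\<Sum>f | coord (m e e) f \<noteq> 0. s (coord (m e e) f) f)"
    using sum_nonzero_representation_eq[OF independent_B] span_B by simp
  also have "\<dots> \<in> span C"
    using sup by (intro span_sum span_scale span_base) auto
  finally show ?thesis .
qed

lemma centroidal_scalar_on_component:
  assumes T: "centroidal T" and C: "C \<in> components"
  shows "\<exists>c. \<forall>x\<in>span C. T x = s c x"
proof -
  obtain e where e: "e \<in> C" using component_nonempty[OF C] by blast
  have on_C: "T f = s (coord (T e) e) f" if "f \<in> C" for f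
  proof -
    have "(e, f) \<in> linked" using component_eq[OF C e] that by blast
    then show ?thesis
      using eigenvalue_linked[OF T] centroidal_basis[OF T, of f] component_subset[OF C] that
      by auto
  qed
  have lin: "Vector_Spaces.linear s s (s (coord (T e) e))"
    by (rule linear_endoI) (simp_all add: scale_right_distrib mult.commute)
  have "T x = s (coord (T e) e) x" if "x \<in> span C" for x
    using endo.linear_eq_on[OF centroidal_linear[OF T] lin that] on_C by blast
  then show ?thesis by blast
qed

text \<open>Conversely, scalars can be prescribed freely on the components: the square of a basis vector
  stays in the span of its component, where the map is a homothety.\<close>

lemma ex_centroidal:
  obtains T where "centroidal T" and "\<And>C x. C \<in> components \<Longrightarrow> x \<in> span C \<Longrightarrow> T x = s (\<phi> C) x"
proof -
  define T where "T = endo.construct B (\<lambda>e. s (\<phi> (linked `` {e})) e)"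
  have lin: "Vector_Spaces.linear s s T"
    unfolding T_def by (rule endo.linear_construct[OF independent_B])
  have basis_val: "T e = s (\<phi> (linked `` {e})) e" if "e \<in> B" for e
    unfolding T_def by (rule endo.construct_basis[OF independent_B that])
  have scalar: "T x = s (\<phi> C) x" if C: "C \<in> components" and x: "x \<in> span C" for C x
  proof (rule endo.linear_eq_on[OF lin _ x])
    show "Vector_Spaces.linear s s (s (\<phi> C))"
      by (rule linear_endoI) (simp_all add: scale_right_distrib mult.commute)
    show "T e = s (\<phi> C) e" if "e \<in> C" for e
      using basis_val[of e] component_eq[OF C that] component_subset[OF C] that by auto
  qed
  have square: "T (m e e) = s (\<phi> (linked `` {e})) (m e e)" if "e \<in> B" for e
    using scalar[OF component_of[OF that]] square_in_component_span[OF component_of[OF that], of e]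
    by blast
  have basis_right: "T (m x e) = m x (T e)" if e: "e \<in> B" for x e
  proof -
    have "T (m x e) = s (coord x e) (T (m e e))"
      by (subst mult_basis_right[OF e]) (rule linear_endoD(2)[OF lin])
    also have "\<dots> = s (\<phi> (linked `` {e})) (s (coord x e) (m e e))"
      unfolding square[OF e] by (simp add: mult.commute)
    also have "\<dots> = m x (T e)"
      unfolding mult_basis_right[OF e, of x, symmetric] basis_val[OF e] by (rule mult_scale_right[symmetric])
    finally show ?thesis .
  qed
  have basis_left: "T (m e x) = m (T e) x" if e: "e \<in> B" for x e
  proof -
    have "T (m e x) = s (coord x e) (T (m e e))"
      by (subst mult_basis_left[OF e]) (rule linear_endoD(2)[OF lin])
    also have "\<dots> = s (\<phi> (linked `` {e})) (s (coord x e) (m e e))"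
      unfolding square[OF e] by (simp add: mult.commute)
    also have "\<dots> = m (T e) x"
      unfolding mult_basis_left[OF e, of x, symmetric] basis_val[OF e] by (rule mult_scale_left[symmetric])
    finally show ?thesis .
  qed
  have right: "T (m x y) = m x (T y)" for x y
    by (rule linear_eq_on_basis[of "\<lambda>y. T (m x y)" "\<lambda>y. m x (T y)"])
      (auto intro!: linear_endoI simp: mult_add_right mult_scale_right linear_endoD[OF lin] basis_right)
  have left: "T (m x y) = m (T x) y" for x y
    by (rule linear_eq_on_basis[of "\<lambda>x. T (m x y)" "\<lambda>x. m (T x) y"])
      (auto intro!: linear_endoI simp: mult_add_left mult_scale_left linear_endoD[OF lin] basis_left)
  show ?thesis
    by (rule that[of T]) (use lin right left scalar in \<open>auto simp: centroidal_def\<close>)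
qed

lemma linear_eq_on_components:
  assumes "Vector_Spaces.linear s s T" and "Vector_Spaces.linear s s U"
    and "\<And>C x. C \<in> components \<Longrightarrow> x \<in> span C \<Longrightarrow> T x = U x"
  shows "T x = U x"
proof (rule linear_eq_on_basis[OF assms(1,2)])
  fix e assume "e \<in> B"
  then show "T e = U e" using assms(3)[OF component_of span_base] by blast
qed

text \<open>The isomorphism records the scalar by which a centroid element acts on each component. It is
  injective because the components together contain the basis, and surjective because the scalars
  are arbitrary.\<close>

lemma centroid_iso_function_algebra:
  "algebra_isomorphic (centroid s m UNIV) (function_algebra components :: ('k, 'a set \<Rightarrow> 'k) module)"
proof -
  let ?R = "centroid s m UNIV" and ?F = "function_algebra components :: ('k, 'a set \<Rightarrow> 'k) module"
  define h where "h T = (\<lambda>C\<in>components. scalar_on (span C) T)" for T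
  have h_eqI: "h T C = c" if C: "C \<in> components" and val: "\<And>x. x \<in> span C \<Longrightarrow> T x = s c x" for T C c
  proof -
    obtain e where "e \<in> span C" "e \<noteq> 0" using component_nonempty[OF C] by blast
    then show ?thesis using scalar_on_eqI[of e "span C" T c] C val by (simp add: h_def)
  qed
  have act: "T x = s (h T C) x" if "T \<in> carrier ?R" "C \<in> components" "x \<in> span C" for T C x
    using centroidal_scalar_on_component[of T C] h_eqI[of C T] that by (metis centroid_UNIV_iff)
  have linear: "Vector_Spaces.linear s s T" if "T \<in> carrier ?R" for T
    using that centroidal_linear centroid_UNIV_iff by blast
  have ext: "h T = f" if "f \<in> extensional components"
    "\<And>C x. C \<in> components \<Longrightarrow> x \<in> span C \<Longrightarrow> T x = s (f C) x" for T f
    by (rule extensionalityI[OF _ that(1)]) (use h_eqI that(2) in \<open>auto simp: h_def\<close>)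
  have mult: "h (mult ?R T U) = mult ?F (h T) (h U)"
    if "T \<in> carrier ?R" "U \<in> carrier ?R" for T U
  proof (rule ext)
    fix C x assume C: "C \<in> components" and x: "x \<in> span C"
    have "T (U x) = s (h T C) (U x)"
      using act[OF that(1) C] act[OF that(2) C x] span_scale[OF x] by metis
    then show "mult ?R T U x = s (mult ?F (h T) (h U) C) x"
      using C act[OF that(2) C x] by (simp add: centroid_def compose_def function_algebra_def)
  qed (simp add: function_algebra_def)
  have add: "h (add ?R T U) = add ?F (h T) (h U)"
    if "T \<in> carrier ?R" "U \<in> carrier ?R" for T U
    by (rule ext) (auto simp: centroid_def function_algebra_def scale_left_distrib
        act[OF that(1), symmetric] act[OF that(2), symmetric])
  have one: "h (one ?R) = one ?F"
    by (rule ext) (auto simp: centroid_def function_algebra_def)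
  have smult: "h (smult ?R c T) = smult ?F c (h T)" if "T \<in> carrier ?R" for c T
    by (rule ext) (auto simp: centroid_def function_algebra_def act[OF that, symmetric]
        simp del: scale_scale simp add: scale_scale[symmetric])
  have carrier: "h T \<in> carrier ?F" for T by (simp add: h_def function_algebra_def)
  have bij: "bij_betw h (carrier ?R) (carrier ?F)"
  proof (rule bij_betw_imageI)
    show "inj_on h (carrier ?R)"
    proof (intro inj_onI HOL.ext)
      fix T U x assume T: "T \<in> carrier ?R" and U: "U \<in> carrier ?R" and eq: "h T = h U"
      show "T x = U x"
      proof (rule linear_eq_on_components[OF linear[OF T] linear[OF U]])
        show "T y = U y" if "C \<in> components" "y \<in> span C" for C y
          using act[OF T that] act[OF U that] eq by simp
      qed
    qed
    show "h ` carrier ?R = carrier ?F"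
    proof (intro equalityI subsetI)
      fix f assume f: "f \<in> carrier ?F"
      obtain T where "centroidal T" "\<And>C x. C \<in> components \<Longrightarrow> x \<in> span C \<Longrightarrow> T x = s (f C) x"
        by (fact ex_centroidal[of f])
      then show "f \<in> h ` carrier ?R"
        using ext[of f T] f centroid_UNIV_iff by (auto simp: function_algebra_def PiE_def)
    qed (use carrier in auto)
  qed
  have "h \<in> ring_iso ?R ?F"
    by (rule ring_iso_memI) (use carrier mult add one bij in auto)
  then show ?thesis unfolding algebra_isomorphic_def using smult by blast
qed

section \<open>The ideals spanned by the components\<close>

text \<open>The projections are the centroid elements whose scalar is \<open>1\<close> on \<open>C\<close> and \<open>0\<close> elsewhere.\<close>

lemma ex_component_projection:
  assumes "C \<in> components"
  obtains P where "centroidal P" and "\<And>x. P x \<in> span C" and "\<And>x. x \<in> span C \<Longrightarrow> P x = x"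
    and "\<And>D x. D \<in> components \<Longrightarrow> D \<noteq> C \<Longrightarrow> x \<in> span D \<Longrightarrow> P x = 0"
proof -
  obtain P where P: "centroidal P"
    and val: "\<And>D x. D \<in> components \<Longrightarrow> x \<in> span D \<Longrightarrow> P x = s (if D = C then 1 else 0) x"
    by (fact ex_centroidal[of "\<lambda>D. if D = C then 1 else 0"])
  have basis_in: "P e \<in> span C" if "e \<in> B" for e
  proof -
    have e_in: "e \<in> span (linked `` {e})" by (rule span_base) blast
    then have "P e = s (if linked `` {e} = C then 1 else 0) e"
      by (rule val[OF component_of[OF that]])
    then show ?thesis using e_in span_zero by (cases "linked `` {e} = C") simp_all
  qed
  have "P x \<in> span C" for x
  proof -
    have "P ` B \<subseteq> span C" using basis_in by blast
    then have "span (P ` B) \<subseteq> span C" by (rule span_minimal) simp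
    then show ?thesis
      using endo.linear_span_image[OF centroidal_linear[OF P], of B] span_B by blast
  qed
  then show ?thesis using that[OF P] val assms by simp
qed

text \<open>The range of a projection \<open>P\<close> in the centroid absorbs products, since \<open>x = P x\<close> gives
  \<open>m x y = P (m x y)\<close>.\<close>

lemma component_span_ideal:
  assumes "C \<in> components" shows "alg_ideal s m UNIV (span C)"
proof -
  obtain P where P: "centroidal P" "\<And>x. P x \<in> span C" "\<And>x. x \<in> span C \<Longrightarrow> P x = x"
    "\<And>D x. D \<in> components \<Longrightarrow> D \<noteq> C \<Longrightarrow> x \<in> span D \<Longrightarrow> P x = 0"
    by (fact ex_component_projection[OF assms])
  have "m x y \<in> span C \<and> m y x \<in> span C" if "x \<in> span C" for x y
    using centroidal_mult_left[OF P(1), of x y] centroidal_mult_right[OF P(1), of y x]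
      P(2)[of "m x y"] P(2)[of "m y x"] P(3)[OF that] by simp
  then show ?thesis by (simp add: alg_ideal_def)
qed

lemma component_span_nonzero: "C \<in> components \<Longrightarrow> span C \<noteq> {0}"
  using component_nonempty by blast

text \<open>A centroid element of the ideal, precomposed with the projection onto it, is a centroid
  element of the whole algebra, and these are homotheties on each component.\<close>

lemma component_centroid_scalar:
  assumes C: "C \<in> components" and T: "T \<in> carrier (centroid s m (span C))"
  shows "\<exists>c. \<forall>x\<in>span C. T x = s c x"
proof -
  obtain P where P: "centroidal P" "\<And>x. P x \<in> span C" "\<And>x. x \<in> span C \<Longrightarrow> P x = x"
    "\<And>D x. D \<in> components \<Longrightarrow> D \<noteq> C \<Longrightarrow> x \<in> span D \<Longrightarrow> P x = 0"
    by (fact ex_component_projection[OF C])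
  have T_in: "T x \<in> span C" if "x \<in> span C" for x using T that by (auto simp: centroid_def)
  have T_add: "T (x + y) = T x + T y" if "x \<in> span C" "y \<in> span C" for x y
    using T that by (auto simp: centroid_def)
  have T_scale: "T (s c x) = s c (T x)" if "x \<in> span C" for c x
    using T that by (auto simp: centroid_def)
  have T_mult: "T (m x y) = m x (T y)" "T (m x y) = m (T x) y" if "x \<in> span C" "y \<in> span C" for x y
    using T that unfolding centroid_carrier_iff by blast+
  have P_mult: "P (m x y) = m (P x) (P y)" for x y
  proof -
    have "P (m x y) = P (P (m x y))" using P(2,3) by simp
    also have "P (m x y) = m x (P y)" by (rule centroidal_mult_right[OF P(1)])
    also have "P (m x (P y)) = m (P x) (P y)" by (rule centroidal_mult_left[OF P(1)])
    finally show ?thesis unfolding centroidal_mult_right[OF P(1), of x y] .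
  qed
  \<comment> \<open>Only the projection of \<open>x\<close> to the ideal matters when multiplying by an element of the ideal.\<close>
  have absorb: "m (P x) z = m x z" "m z (P x) = m z x" if "z \<in> span C" for x z
    using centroidal_mult_left[OF P(1), of x z] centroidal_mult_right[OF P(1), of x z]
      centroidal_mult_left[OF P(1), of z x] centroidal_mult_right[OF P(1), of z x]
      P(3)[OF that] by simp_all
  have "centroidal (\<lambda>x. T (P x))"
    unfolding centroidal_def
  proof (intro conjI allI)
    show "Vector_Spaces.linear s s (\<lambda>x. T (P x))"
      by (rule linear_endoI) (simp_all add: linear_endoD[OF centroidal_linear[OF P(1)]] T_add T_scale P(2))
    show "T (P (m x y)) = m x (T (P y))" "T (P (m x y)) = m (T (P x)) y" for x y
      unfolding P_mult
      using absorb[OF T_in[OF P(2)]] T_mult[OF P(2) P(2)] by simp_all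
  qed
  then show ?thesis using centroidal_scalar_on_component[OF _ C] P(3) by metis
qed

lemma component_span_inj: "inj_on span components"
proof (rule inj_onI, rule ccontr)
  fix C D assume C: "C \<in> components" and D: "D \<in> components" and eq: "span C = span D" and "C \<noteq> D"
  obtain P where "centroidal P" "\<And>x. P x \<in> span C" and P: "\<And>x. x \<in> span C \<Longrightarrow> P x = x"
    "\<And>D x. D \<in> components \<Longrightarrow> D \<noteq> C \<Longrightarrow> x \<in> span D \<Longrightarrow> P x = 0"
    by (fact ex_component_projection[OF C])
  obtain e where "e \<in> span C" "e \<noteq> 0" using component_nonempty[OF C] by blast
  then show False using P D eq \<open>C \<noteq> D\<close> by metis
qed

text \<open>The projection onto the span of one component kills the spans of all the others, hence the
  intersection of its range with their sum.\<close>

lemma component_spans_direct_sum: "direct_sum_family s (span ` components) (\<lambda>I. I)"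
  unfolding direct_sum_family_def
proof (intro conjI ballI)
  show "subspace I" if "I \<in> span ` components" for I using that by auto
  have "e \<in> (\<Union>I\<in>span ` components. I)" if "e \<in> B" for e
    using component_of[OF that] span_base[of e "linked `` {e}"] by blast
  then have "span B \<subseteq> span (\<Union>I\<in>span ` components. I)" by (intro span_mono subsetI)
  then show "span (\<Union>I\<in>span ` components. I) = UNIV" using span_B by blast
next
  fix I assume "I \<in> span ` components"
  then obtain C where C: "C \<in> components" and I: "I = span C" by blast
  obtain P where P: "centroidal P" and "\<And>x. P x \<in> span C" and P_id: "\<And>x. x \<in> span C \<Longrightarrow> P x = x"
    and P_0: "\<And>D x. D \<in> components \<Longrightarrow> D \<noteq> C \<Longrightarrow> x \<in> span D \<Longrightarrow> P x = 0"
    by (fact ex_component_projection[OF C])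
  have "P x = 0" if "x \<in> span (\<Union>J\<in>span ` components - {I}. J)" for x
    by (rule endo.linear_eq_0_on_span[OF centroidal_linear[OF P] _ that]) (use P_0 I in auto)
  then have "x = 0" if "x \<in> I" "x \<in> span (\<Union>J\<in>span ` components - {I}. J)" for x
    using P_id I that by metis
  then show "I \<inter> span (\<Union>J\<in>span ` components - {I}. J) = {0}"
    using I span_zero by blast
qed

text \<open>An idempotent of the centroid acts on each component by \<open>0\<close> or \<open>1\<close>, the only idempotents of a
  field; if it is not zero, it acts by \<open>1\<close> on some component.\<close>

lemma idempotent_range_contains_component:
  assumes T: "centroidal T" and idem: "\<And>x. T (T x) = T x" and nz: "T y \<noteq> 0"
  obtains C where "C \<in> components" and "span C \<subseteq> range T"
proof -
  obtain e where e: "e \<in> B" and Te: "T e \<noteq> 0"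
    using linear_eq_on_basis[OF centroidal_linear[OF T] endo.linear_zero, of y] nz by blast
  let ?C = "linked `` {e}"
  have C: "?C \<in> components" by (rule component_of[OF e])
  obtain c where c: "\<And>x. x \<in> span ?C \<Longrightarrow> T x = s c x"
    using centroidal_scalar_on_component[OF T C] by blast
  have e_in: "e \<in> span ?C" by (rule span_base) blast
  have "s (c * c) e = T (s c e)" using c[OF span_scale[OF e_in]] by simp
  also have "\<dots> = T (T e)" using c[OF e_in] by simp
  also have "\<dots> = s c e" unfolding idem by (rule c[OF e_in])
  finally have "c * c = c" using basis_nonzero[OF e] by simp
  moreover have "c \<noteq> 0" using Te c[OF e_in] by auto
  ultimately have "c = 1" by simp
  then have "span ?C \<subseteq> range T" using c by (metis rangeI scale_one subsetI)
  then show ?thesis using that C by blast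
qed

end

section \<open>Comparison of two natural bases\<close>

text \<open>The projection onto the span of a component \<open>C\<close> of one basis is an idempotent of the centroid,
  hence its range contains the span of a component \<open>D\<close> of the other basis. The same argument for
  \<open>D\<close> gives a component of the first basis whose span lies inside that of \<open>D\<close>, and so inside
  that of \<open>C\<close>; it must be \<open>C\<close> itself, since distinct components of one basis have independent
  spans. So the span of \<open>D\<close> is squeezed between two copies of the span of \<open>C\<close>.\<close>

lemma component_spans_subset:
  assumes "zero_annihilator_evolution_algebra s m B" and "zero_annihilator_evolution_algebra s m B'"
  shows "module.span s ` graph_components s m B \<subseteq> module.span s ` graph_components s m B'"
proof
  interpret b: zero_annihilator_evolution_algebra s m B by fact
  interpret b': zero_annihilator_evolution_algebra s m B' by fact
  fix I assume "I \<in> b.span ` b.components"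
  then obtain C where C: "C \<in> b.components" and I: "I = b.span C" by blast
  obtain P where P: "b.centroidal P" "\<And>x. P x \<in> b.span C" "\<And>x. x \<in> b.span C \<Longrightarrow> P x = x"
    "\<And>D x. D \<in> b.components \<Longrightarrow> D \<noteq> C \<Longrightarrow> x \<in> b.span D \<Longrightarrow> P x = 0"
    by (fact b.ex_component_projection[OF C])
  obtain e where e: "e \<in> b.span C" "e \<noteq> 0" using b.component_nonempty[OF C] by blast
  obtain D where D: "D \<in> b'.components" "b.span D \<subseteq> range P"
    using b'.idempotent_range_contains_component[of P e] P(1-3) e by metis
  then have DC: "b.span D \<subseteq> b.span C" using P(2) by blast
  obtain Q where Q: "b.centroidal Q" "\<And>x. Q x \<in> b.span D" "\<And>x. x \<in> b.span D \<Longrightarrow> Q x = x"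
    "\<And>E x. E \<in> b'.components \<Longrightarrow> E \<noteq> D \<Longrightarrow> x \<in> b.span E \<Longrightarrow> Q x = 0"
    by (fact b'.ex_component_projection[OF D(1)])
  obtain d where d: "d \<in> b.span D" "d \<noteq> 0" using b'.component_nonempty[OF D(1)] by blast
  obtain E where E: "E \<in> b.components" "b.span E \<subseteq> range Q"
    using b.idempotent_range_contains_component[of Q d] Q d by metis
  then have ED: "b.span E \<subseteq> b.span D" using Q(2) by blast
  obtain f where f: "f \<in> b.span E" "f \<noteq> 0" using b.component_nonempty[OF E(1)] by blast
  have "P f = f" using f(1) ED DC P(3) by blast
  then have "E = C" using P(4)[OF E(1) _ f(1)] f(2) by metis
  then have "I = b.span D" using ED DC I by blast
  then show "I \<in> b.span ` b'.components" using D(1) by blast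
qed


theorem theorem4p5:
  fixes s :: "'k::field \<Rightarrow> 'a::ab_group_add \<Rightarrow> 'a"
    and m :: "'a \<Rightarrow> 'a \<Rightarrow> 'a"
  assumes "evolution_algebra s m"
    and "annihilator m = {0}"
  shows "\<exists>(\<Gamma> :: 'a set set) (F :: 'a set \<Rightarrow> 'a set).
           direct_sum_family s \<Gamma> F \<and>
           (\<forall>\<alpha>\<in>\<Gamma>. alg_ideal s m UNIV (F \<alpha>) \<and> F \<alpha> \<noteq> {0} \<and>
                  \<not> decomposable s m (F \<alpha>) \<and>
                  algebra_isomorphic (centroid s m (F \<alpha>)) (base_algebra :: ('k, 'k) module)) \<and>
           (\<forall>B. natural_basis s m B \<longrightarrow>
                  algebra_isomorphic (centroid s m UNIV) (function_algebra (graph_components s m B)) \<and>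
                  \<Gamma> \<approx> graph_components s m B)"
proof -
  have evolution: "zero_annihilator_evolution_algebra s m B" if "natural_basis s m B" for B
    using assms that
    by (simp add: zero_annihilator_evolution_algebra_def
        zero_annihilator_evolution_algebra_axioms_def evolution_algebra_def)
  obtain B where B: "natural_basis s m B"
    using assms(1) evolution_algebra.ex_natural_basis by blast
  interpret zero_annihilator_evolution_algebra s m B by (rule evolution[OF B])
  (* The index set is the set of ideals itself, so that it does not depend on the basis chosen. *)
  let ?\<Gamma> = "span ` components"
  have ideals: "alg_ideal s m UNIV I \<and> I \<noteq> {0} \<and> \<not> decomposable s m I \<and>
      algebra_isomorphic (centroid s m I) (base_algebra :: ('k, 'k) module)" if I_in: "I \<in> ?\<Gamma>" for I
  proof -
    obtain C where C: "C \<in> components" and I: "I = span C" using I_in by blast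
    have closed: "m x y \<in> span C" if "x \<in> span C" for x y
      using component_span_ideal[OF C] that by (simp add: alg_ideal_def)
    note scalar = component_centroid_scalar[OF C]
    show ?thesis
      unfolding I
      using component_span_ideal[OF C] component_span_nonzero[OF C]
        scalar_centroid_imp_indecomposable[OF scalar]
        centroid_iso_base_algebra[OF subspace_span closed component_span_nonzero[OF C] scalar]
      by blast
  qed
  have any_basis: "algebra_isomorphic (centroid s m UNIV)
        (function_algebra (graph_components s m B') :: ('k, 'a set \<Rightarrow> 'k) module) \<and>
      ?\<Gamma> \<approx> graph_components s m B'" if B': "natural_basis s m B'" for B'
  proof -
    interpret b': zero_annihilator_evolution_algebra s m B' by (rule evolution[OF B'])
    have "?\<Gamma> = span ` b'.components"
      using component_spans_subset[OF evolution[OF B] evolution[OF B']]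
        component_spans_subset[OF evolution[OF B'] evolution[OF B]] by (rule equalityI)
    then have "?\<Gamma> \<approx> b'.components"
      using inj_on_image_eqpoll_self[OF b'.component_span_inj] by simp
    then show ?thesis using b'.centroid_iso_function_algebra by blast
  qed
  show ?thesis
    by (rule exI[of _ ?\<Gamma>], rule exI[of _ "\<lambda>I. I"])
      (use component_spans_direct_sum ideals any_basis in blast)
qed

end
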